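(* Let $\Phi:\mathsf X\to\mathsf B$ be a functor which is both a fibration and a cofibration. Assume that $\mathsf B$ and all fibres $\mathsf X_I$ ($I\in\mathsf B$) are cocomplete. Let $T:\mathsf C\to\mathsf X$ be a functor from a small connected category $\mathsf C$. Then $\operatorname{colim}T$ exists and may be calculated as follows. (i) First calculate $I=\operatorname{colim}(\Phi T)$, with cocone $\gamma:\Phi T\Rightarrow I$. (ii) For each $c\in\mathsf C$ choose cocartesian morphisms $\gamma'(c):T(c)\to X(c)$ over $\gamma(c)$, where $X(c)\in\mathsf X_I$. (iii) Make $c\mapsto X(c)$ into a functor $X:\mathsf C\to\mathsf X_I$, so that $\gamma'$ becomes a natural transformation $\gamma':T\Rightarrow X$. (iv) Form $Y=\operatorname{colim}X\in\mathsf X_I$ with cocone $\mu:X\Rightarrow Y$. Then $Y$ with $\mu\gamma':T\Rightarrow Y$ is $\operatorname{colim}T$.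
   Context: For a functor $\Phi:\mathsf X\to\mathsf B$, a morphism $\varphi:Y\to X$ with $\Phi(\varphi)=u:J\to I$ is cartesian if for all $v:K\to J$ and all $\theta:Z\to X$ with $\Phi(\theta)=uv$ there is a unique $\psi:Z\to Y$ with $\Phi(\psi)=v$ and $\theta=\varphi\psi$. $\Phi$ is a fibration if for all $u:J\to I$ and all $X$ over $I$ there is a cartesian morphism $Y\to X$ over $u$. A morphism $\psi:Z\to Y$ with $\Phi(\psi)=v:K\to J$ is cocartesian if for all $u:J\to I$ and all $\theta:Z\to X$ with $\Phi(\theta)=uv$ there is a unique $\varphi:Y\to X$ with $\Phi(\varphi)=u$ and $\theta=\varphi\psi$. $\Phi$ is a cofibration if for all $v:K\to J$ and all $Z$ over $K$ there is a cocartesian morphism $Z\to Z'$ over $v$. The fibre $\mathsf X_I$ is the subcategory of objects over $I$ and morphisms over $\mathrm{id}_I$. A category $\mathsf C$ is connected if for any objects $c,c'$ of $\mathsf C$ there is a sequence of objects $c_0=c,c_1,\ldots,c_{n-1},c_n=c'$ such that for each $i=0,\ldots,n-1$ there is a morphism $c_i\to c_{i+1}$ or $c_{i+1}\to c_i$ in $\mathsf C$. *)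

theory Defs
  imports Main
begin

section \<open>Categories, functors, natural transformations\<close>

record ('o, 'a) category =
  Obj :: "'o set"
  Arr :: "'a set"
  Dom :: "'a \<Rightarrow> 'o"
  Cod :: "'a \<Rightarrow> 'o"
  Ide :: "'o \<Rightarrow> 'a"
  Comp :: "'a \<Rightarrow> 'a \<Rightarrow> 'a"  (infixl "\<cdot>\<index>" 70)

text \<open>
  Only the values on \<^term>\<open>Obj\<close>, \<^term>\<open>Arr\<close> and composable pairs are meaningful. Composition
  is written in applicative order, so \<open>g \<cdot>\<^bsub>C\<^esub> f\<close> is defined when \<open>Cod C f = Dom C g\<close>.
\<close>

definition Hom :: "('o, 'a) category \<Rightarrow> 'o \<Rightarrow> 'o \<Rightarrow> 'a set" where
  "Hom C a b = {f \<in> Arr C. Dom C f = a \<and> Cod C f = b}"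

locale category =
  fixes C :: "('o, 'a) category" (structure)
  assumes Dom_in_Obj: "f \<in> Arr C \<Longrightarrow> Dom C f \<in> Obj C"
    and Cod_in_Obj: "f \<in> Arr C \<Longrightarrow> Cod C f \<in> Obj C"
    and Ide_in_Hom: "a \<in> Obj C \<Longrightarrow> Ide C a \<in> Hom C a a"
    and Comp_in_Hom: "f \<in> Hom C a b \<Longrightarrow> g \<in> Hom C b c \<Longrightarrow> g \<cdot> f \<in> Hom C a c"
    and Comp_Ide: "f \<in> Arr C \<Longrightarrow> f \<cdot> Ide C (Dom C f) = f"
    and Ide_Comp: "f \<in> Arr C \<Longrightarrow> Ide C (Cod C f) \<cdot> f = f"
    and Comp_assoc: "f \<in> Hom C a b \<Longrightarrow> g \<in> Hom C b c \<Longrightarrow> h \<in> Hom C c d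
      \<Longrightarrow> (h \<cdot> g) \<cdot> f = h \<cdot> (g \<cdot> f)"

record ('o1, 'a1, 'o2, 'a2) cat_map =
  on_Obj :: "'o1 \<Rightarrow> 'o2"
  on_Arr :: "'a1 \<Rightarrow> 'a2"

locale cat_functor = C: category C + D: category D
  for C :: "('o1, 'a1) category" and D :: "('o2, 'a2) category" +
  fixes F :: "('o1, 'a1, 'o2, 'a2) cat_map"
  assumes on_Obj_in_Obj: "a \<in> Obj C \<Longrightarrow> on_Obj F a \<in> Obj D"
    and on_Arr_in_Hom: "f \<in> Hom C a b \<Longrightarrow> on_Arr F f \<in> Hom D (on_Obj F a) (on_Obj F b)"
    and on_Arr_Ide: "a \<in> Obj C \<Longrightarrow> on_Arr F (Ide C a) = Ide D (on_Obj F a)"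
    and on_Arr_Comp: "f \<in> Hom C a b \<Longrightarrow> g \<in> Hom C b c
      \<Longrightarrow> on_Arr F (g \<cdot>\<^bsub>C\<^esub> f) = on_Arr F g \<cdot>\<^bsub>D\<^esub> on_Arr F f"

definition comp_map ::
  "('o2, 'a2, 'o3, 'a3) cat_map \<Rightarrow> ('o1, 'a1, 'o2, 'a2) cat_map \<Rightarrow> ('o1, 'a1, 'o3, 'a3) cat_map"
  where "comp_map G F = \<lparr>on_Obj = on_Obj G \<circ> on_Obj F, on_Arr = on_Arr G \<circ> on_Arr F\<rparr>"

definition const_map :: "('o2, 'a2) category \<Rightarrow> 'o2 \<Rightarrow> ('o1, 'a1, 'o2, 'a2) cat_map" where
  "const_map D Y = \<lparr>on_Obj = (\<lambda>_. Y), on_Arr = (\<lambda>_. Ide D Y)\<rparr>"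

locale nat_trans = F: cat_functor C D F + G: cat_functor C D G
  for C :: "('o1, 'a1) category" and D :: "('o2, 'a2) category"
    and F G :: "('o1, 'a1, 'o2, 'a2) cat_map" +
  fixes \<tau> :: "'o1 \<Rightarrow> 'a2"
  assumes component_in_Hom: "c \<in> Obj C \<Longrightarrow> \<tau> c \<in> Hom D (on_Obj F c) (on_Obj G c)"
    and natural: "f \<in> Hom C c c' \<Longrightarrow> \<tau> c' \<cdot>\<^bsub>D\<^esub> on_Arr F f = on_Arr G f \<cdot>\<^bsub>D\<^esub> \<tau> c"

section \<open>Colimits, smallness, connectedness\<close>

definition cocone ::
  "('o1, 'a1) category \<Rightarrow> ('o2, 'a2) category \<Rightarrow> ('o1, 'a1, 'o2, 'a2) cat_map
    \<Rightarrow> 'o2 \<Rightarrow> ('o1 \<Rightarrow> 'a2) \<Rightarrow> bool"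
  where "cocone C D F Y \<mu> \<longleftrightarrow> Y \<in> Obj D \<and> nat_trans C D F (const_map D Y) \<mu>"

definition is_colimit ::
  "('o1, 'a1) category \<Rightarrow> ('o2, 'a2) category \<Rightarrow> ('o1, 'a1, 'o2, 'a2) cat_map
    \<Rightarrow> 'o2 \<Rightarrow> ('o1 \<Rightarrow> 'a2) \<Rightarrow> bool"
  where "is_colimit C D F Y \<mu> \<longleftrightarrow>
    cocone C D F Y \<mu> \<and>
    (\<forall>Z \<theta>. cocone C D F Z \<theta> \<longrightarrow>
      (\<exists>!h. h \<in> Hom D Y Z \<and> (\<forall>c\<in>Obj C. h \<cdot>\<^bsub>D\<^esub> \<mu> c = \<theta> c)))"

text \<open>
  Size is measured against a type \<open>'u\<close>, an arbitrary type playing the role of the universe: a set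
  is small if its cardinality is strictly below that of \<open>'u\<close>, just as the small sets are those
  of cardinality below that of the universe. Every small category is isomorphic to one whose
  objects and arrows are elements of \<open>'u\<close>, so those suffice as shapes in the definition of
  cocompleteness.
\<close>

definition small_set :: "'u itself \<Rightarrow> 'x set \<Rightarrow> bool" where
  "small_set U A \<longleftrightarrow> (card_of A, card_of (UNIV :: 'u set)) \<in> ordLess"

definition small_category :: "'u itself \<Rightarrow> ('o, 'a) category \<Rightarrow> bool" where
  "small_category U C \<longleftrightarrow> category C \<and> small_set U (Obj C) \<and> small_set U (Arr C)"

definition cocomplete :: "'u itself \<Rightarrow> ('o, 'a) category \<Rightarrow> bool" where
  "cocomplete U D \<longleftrightarrow> category D \<and>
    (\<forall>(J :: ('u, 'u) category) F.
      small_category U J \<and> cat_functor J D F \<longrightarrow> (\<exists>Y \<mu>. is_colimit J D F Y \<mu>))"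

definition connected_category :: "('o, 'a) category \<Rightarrow> bool" where
  "connected_category C \<longleftrightarrow> category C \<and>
    (\<forall>c\<in>Obj C. \<forall>c'\<in>Obj C. \<exists>(n :: nat) z. z 0 = c \<and> z n = c' \<and> (\<forall>i\<le>n. z i \<in> Obj C) \<and>
      (\<forall>i<n. Hom C (z i) (z (Suc i)) \<noteq> {} \<or> Hom C (z (Suc i)) (z i) \<noteq> {}))"

section \<open>Fibrations and cofibrations\<close>

definition cartesian ::
  "('xo, 'xa) category \<Rightarrow> ('bo, 'ba) category \<Rightarrow> ('xo, 'xa, 'bo, 'ba) cat_map \<Rightarrow> 'xa \<Rightarrow> bool"
  where "cartesian X B \<Phi> \<phi> \<longleftrightarrow> \<phi> \<in> Arr X \<and>
    (\<forall>v\<in>Arr B. \<forall>\<theta>\<in>Arr X.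
      Cod B v = Dom B (on_Arr \<Phi> \<phi>) \<and> Cod X \<theta> = Cod X \<phi> \<and>
      on_Arr \<Phi> \<theta> = on_Arr \<Phi> \<phi> \<cdot>\<^bsub>B\<^esub> v \<longrightarrow>
      (\<exists>!\<psi>. \<psi> \<in> Hom X (Dom X \<theta>) (Dom X \<phi>) \<and> on_Arr \<Phi> \<psi> = v \<and> \<theta> = \<phi> \<cdot>\<^bsub>X\<^esub> \<psi>))"

definition cocartesian ::
  "('xo, 'xa) category \<Rightarrow> ('bo, 'ba) category \<Rightarrow> ('xo, 'xa, 'bo, 'ba) cat_map \<Rightarrow> 'xa \<Rightarrow> bool"
  where "cocartesian X B \<Phi> \<psi> \<longleftrightarrow> \<psi> \<in> Arr X \<and>
    (\<forall>u\<in>Arr B. \<forall>\<theta>\<in>Arr X.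
      Dom B u = Cod B (on_Arr \<Phi> \<psi>) \<and> Dom X \<theta> = Dom X \<psi> \<and>
      on_Arr \<Phi> \<theta> = u \<cdot>\<^bsub>B\<^esub> on_Arr \<Phi> \<psi> \<longrightarrow>
      (\<exists>!\<phi>. \<phi> \<in> Hom X (Cod X \<psi>) (Cod X \<theta>) \<and> on_Arr \<Phi> \<phi> = u \<and> \<theta> = \<phi> \<cdot>\<^bsub>X\<^esub> \<psi>))"

definition fibration ::
  "('xo, 'xa) category \<Rightarrow> ('bo, 'ba) category \<Rightarrow> ('xo, 'xa, 'bo, 'ba) cat_map \<Rightarrow> bool"
  where "fibration X B \<Phi> \<longleftrightarrow> cat_functor X B \<Phi> \<and>
    (\<forall>u\<in>Arr B. \<forall>A\<in>Obj X. on_Obj \<Phi> A = Cod B u \<longrightarrow>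
      (\<exists>\<phi>. cartesian X B \<Phi> \<phi> \<and> Cod X \<phi> = A \<and> on_Arr \<Phi> \<phi> = u))"

definition cofibration ::
  "('xo, 'xa) category \<Rightarrow> ('bo, 'ba) category \<Rightarrow> ('xo, 'xa, 'bo, 'ba) cat_map \<Rightarrow> bool"
  where "cofibration X B \<Phi> \<longleftrightarrow> cat_functor X B \<Phi> \<and>
    (\<forall>v\<in>Arr B. \<forall>A\<in>Obj X. on_Obj \<Phi> A = Dom B v \<longrightarrow>
      (\<exists>\<psi>. cocartesian X B \<Phi> \<psi> \<and> Dom X \<psi> = A \<and> on_Arr \<Phi> \<psi> = v))"

definition fibre ::
  "('xo, 'xa) category \<Rightarrow> ('bo, 'ba) category \<Rightarrow> ('xo, 'xa, 'bo, 'ba) cat_map \<Rightarrow> 'bo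
    \<Rightarrow> ('xo, 'xa) category"
  where "fibre X B \<Phi> I =
    X\<lparr>Obj := {A \<in> Obj X. on_Obj \<Phi> A = I}, Arr := {f \<in> Arr X. on_Arr \<Phi> f = Ide B I}\<rparr>"

lemma category_fibre:
  assumes "cat_functor X B \<Phi>" and I: "I \<in> Obj B"
  shows "category (fibre X B \<Phi> I)"
proof -
  interpret cat_functor X B \<Phi> by fact
  have I': "Dom B (Ide B I) = I" "Cod B (Ide B I) = I" "Ide B I \<cdot>\<^bsub>B\<^esub> Ide B I = Ide B I"
    using D.Ide_in_Hom[OF I] D.Comp_Ide[of "Ide B I"] by (auto simp: Hom_def)
  have over: "on_Obj \<Phi> (Dom X f) = I \<and> on_Obj \<Phi> (Cod X f) = I"
    if "f \<in> Arr X" "on_Arr \<Phi> f = Ide B I" for f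
    using on_Arr_in_Hom[of f "Dom X f" "Cod X f"] that I' by (auto simp: Hom_def)
  show ?thesis
    using over on_Arr_Comp C.Comp_in_Hom C.Comp_assoc C.Comp_Ide C.Ide_Comp C.Ide_in_Hom
      C.Dom_in_Obj C.Cod_in_Obj I'
    by (unfold_locales) (auto simp: fibre_def Hom_def on_Arr_Ide)
qed

text \<open>
  A choice, for each object \<open>c\<close>, of a cocartesian morphism \<open>\<gamma>' c : T c \<rightarrow> X\<^sub>0 c\<close> over \<open>\<gamma> c\<close>.
\<close>

definition cocartesian_choice ::
  "('xo, 'xa) category \<Rightarrow> ('bo, 'ba) category \<Rightarrow> ('xo, 'xa, 'bo, 'ba) cat_map
    \<Rightarrow> ('co, 'ca) category \<Rightarrow> ('co, 'ca, 'xo, 'xa) cat_map \<Rightarrow> 'bo \<Rightarrow> ('co \<Rightarrow> 'ba)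
    \<Rightarrow> ('co \<Rightarrow> 'xo) \<Rightarrow> ('co \<Rightarrow> 'xa) \<Rightarrow> bool"
  where "cocartesian_choice X B \<Phi> C T I \<gamma> X\<^sub>0 \<gamma>' \<longleftrightarrow>
    (\<forall>c\<in>Obj C. X\<^sub>0 c \<in> Obj (fibre X B \<Phi> I) \<and> \<gamma>' c \<in> Hom X (on_Obj T c) (X\<^sub>0 c) \<and>
      on_Arr \<Phi> (\<gamma>' c) = \<gamma> c \<and> cocartesian X B \<Phi> (\<gamma>' c))"

text \<open>
  A functor \<open>F\<close> into the fibre extending the object assignment \<open>X\<^sub>0\<close> and making \<open>\<gamma>'\<close> natural.
  Since a fibre inherits its structure from the total category, the same data \<open>F\<close> serve as
  the composite with the inclusion of the fibre.
\<close>

definition fibre_functor ::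
  "('xo, 'xa) category \<Rightarrow> ('bo, 'ba) category \<Rightarrow> ('xo, 'xa, 'bo, 'ba) cat_map
    \<Rightarrow> ('co, 'ca) category \<Rightarrow> ('co, 'ca, 'xo, 'xa) cat_map \<Rightarrow> 'bo
    \<Rightarrow> ('co \<Rightarrow> 'xo) \<Rightarrow> ('co \<Rightarrow> 'xa) \<Rightarrow> ('co, 'ca, 'xo, 'xa) cat_map \<Rightarrow> bool"
  where "fibre_functor X B \<Phi> C T I X\<^sub>0 \<gamma>' F \<longleftrightarrow>
    cat_functor C (fibre X B \<Phi> I) F \<and> (\<forall>c\<in>Obj C. on_Obj F c = X\<^sub>0 c) \<and>
    nat_trans C X T F \<gamma>'"

end

theory Submission
  imports Defs
begin

text \<open>
  A cocone on \<open>T\<close> with vertex \<open>Z\<close> lies over a cocone on \<open>\<Phi>T\<close>, hence determines \<open>u : I \<rightarrow> \<Phi>Z\<close>. Let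
  \<open>\<kappa> : W \<rightarrow> Z\<close> be cartesian over \<open>u\<close>. Each component \<open>T c \<rightarrow> Z\<close> factors uniquely through the
  cocartesian \<open>\<gamma>' c\<close> and the cartesian \<open>\<kappa>\<close>, with a middle factor \<open>X\<^sub>0 c \<rightarrow> W\<close> in the fibre over \<open>I\<close>.
  These factors form a cocone in that fibre, so the universal property of \<open>Y\<close> can be applied there.
\<close>

section \<open>Functors, cocones and their images under functors\<close>

lemma HomD:
  assumes "f \<in> Hom C a b"
  shows "f \<in> Arr C" "Dom C f = a" "Cod C f = b"
  using assms by (auto simp: Hom_def)

lemma Arr_in_Hom: "f \<in> Arr C \<Longrightarrow> f \<in> Hom C (Dom C f) (Cod C f)"
  by (simp add: Hom_def)

lemma (in category) Ide_Comp_Hom: "f \<in> Hom C a b \<Longrightarrow> Ide C b \<cdot> f = f"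
  using Ide_Comp[of f] by (auto simp: Hom_def)

lemma (in category) Comp_Ide_Hom: "f \<in> Hom C a b \<Longrightarrow> f \<cdot> Ide C a = f"
  using Comp_Ide[of f] by (auto simp: Hom_def)

lemma cat_functor_const_map:
  assumes "category C" "category D" "Y \<in> Obj D"
  shows "cat_functor C D (const_map D Y)"
proof -
  interpret C: category C by fact
  interpret D: category D by fact
  show ?thesis
    using assms(3) D.Ide_in_Hom D.Ide_Comp_Hom[OF D.Ide_in_Hom]
    by unfold_locales (auto simp: const_map_def)
qed

lemma cat_functor_comp_map:
  assumes "cat_functor C D F" "cat_functor D E G"
  shows "cat_functor C E (comp_map G F)"
proof -
  interpret F: cat_functor C D F by fact
  interpret G: cat_functor D E G by fact
  show ?thesis
  proof
    fix f g a b c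
    assume f: "f \<in> Hom C a b" and g: "g \<in> Hom C b c"
    show "on_Arr (comp_map G F) (g \<cdot>\<^bsub>C\<^esub> f) =
        on_Arr (comp_map G F) g \<cdot>\<^bsub>E\<^esub> on_Arr (comp_map G F) f"
      using F.on_Arr_Comp[OF f g] G.on_Arr_Comp[OF F.on_Arr_in_Hom[OF f] F.on_Arr_in_Hom[OF g]]
      by (simp add: comp_map_def)
  qed (use F.on_Obj_in_Obj G.on_Obj_in_Obj F.on_Arr_in_Hom G.on_Arr_in_Hom F.on_Arr_Ide
      G.on_Arr_Ide in \<open>auto simp: comp_map_def\<close>)
qed

text \<open>The constant functor sends every arrow to an identity, so each naturality square of a
  cocone collapses to a triangle. Cocones are built and taken apart in this form below.\<close>

lemma cocone_iff:
  assumes "cat_functor C D F"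
  shows "cocone C D F Y \<mu> \<longleftrightarrow> Y \<in> Obj D \<and> (\<forall>c\<in>Obj C. \<mu> c \<in> Hom D (on_Obj F c) Y) \<and>
    (\<forall>f\<in>Arr C. \<mu> (Cod C f) \<cdot>\<^bsub>D\<^esub> on_Arr F f = \<mu> (Dom C f))" (is "?L \<longleftrightarrow> ?R")
proof
  interpret F: cat_functor C D F by fact
  {
    assume ?L
    then have Y: "Y \<in> Obj D" and n: "nat_trans C D F (const_map D Y) \<mu>"
      by (auto simp: cocone_def)
    interpret nat_trans C D F "const_map D Y" \<mu> by fact
    have h: "\<mu> c \<in> Hom D (on_Obj F c) Y" if "c \<in> Obj C" for c
      using component_in_Hom[OF that] by (simp add: const_map_def)
    show ?R
      using Y h natural[OF Arr_in_Hom] F.D.Ide_Comp_Hom[OF h] F.C.Dom_in_Obj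
      by (simp add: const_map_def)
  next
    assume R: ?R
    then interpret K: cat_functor C D "const_map D Y"
      by (intro cat_functor_const_map F.C.category_axioms F.D.category_axioms) blast
    have "nat_trans C D F (const_map D Y) \<mu>"
    proof
      fix f c c' assume f: "f \<in> Hom C c c'"
      then have "c \<in> Obj C" using F.C.Dom_in_Obj by (auto simp: Hom_def)
      then show "\<mu> c' \<cdot>\<^bsub>D\<^esub> on_Arr F f = on_Arr (const_map D Y) f \<cdot>\<^bsub>D\<^esub> \<mu> c"
        using R HomD[OF f] F.D.Ide_Comp_Hom[of "\<mu> c"] by (auto simp: const_map_def)
    qed (use R in \<open>simp add: const_map_def\<close>)
    with R show ?L by (simp add: cocone_def)
  }
qed

text \<open>Applied to \<Phi>, this moves a cocone on \<open>T\<close> down to the base, where the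
  colimit \<open>I\<close> supplies the comparison morphism \<open>u\<close>.\<close>

lemma cocone_comp_map:
  assumes "cat_functor C D F" "cat_functor D E G" "cocone C D F Y \<mu>"
  shows "cocone C E (comp_map G F) (on_Obj G Y) (\<lambda>c. on_Arr G (\<mu> c))"
proof -
  interpret F: cat_functor C D F by fact
  interpret G: cat_functor D E G by fact
  have R: "Y \<in> Obj D" "\<And>c. c \<in> Obj C \<Longrightarrow> \<mu> c \<in> Hom D (on_Obj F c) Y"
    "\<And>f. f \<in> Arr C \<Longrightarrow> \<mu> (Cod C f) \<cdot>\<^bsub>D\<^esub> on_Arr F f = \<mu> (Dom C f)"
    using assms(3) unfolding cocone_iff[OF assms(1)] by auto
  have "on_Arr G (\<mu> (Cod C f)) \<cdot>\<^bsub>E\<^esub> on_Arr G (on_Arr F f) = on_Arr G (\<mu> (Dom C f))"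
    if f: "f \<in> Arr C" for f
    using G.on_Arr_Comp[OF F.on_Arr_in_Hom[OF Arr_in_Hom[OF f]] R(2)[OF F.C.Cod_in_Obj[OF f]]]
      R(3)[OF f] by simp
  then show ?thesis
    unfolding cocone_iff[OF cat_functor_comp_map[OF assms(1,2)]]
    using R G.on_Obj_in_Obj G.on_Arr_in_Hom by (simp add: comp_map_def)
qed

section \<open>Cocompleteness for shapes of arbitrary type\<close>

text \<open>Strict cardinal inequality gives an embedding into \<open>'u\<close>, and its image is
  equipotent with \<open>A\<close>, so it stays strictly below \<open>'u\<close>. Smallness of the
  image is recorded because the copy of a shape must itself be small.\<close>

lemma small_set_inj:
  assumes "small_set TYPE('u) A"
  obtains e :: "'x \<Rightarrow> 'u" where "inj_on e (A :: 'x set)" "small_set TYPE('u) (e ` A)"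
proof -
  have less: "(card_of A, card_of (UNIV :: 'u set)) \<in> ordLess"
    using assms by (simp add: small_set_def)
  then have "(card_of A, card_of (UNIV :: 'u set)) \<in> ordLeq"
    by (rule ordLess_imp_ordLeq)
  then obtain e :: "'x \<Rightarrow> 'u" where e: "inj_on e A"
    unfolding card_of_ordLeq[symmetric] by blast
  then have "bij_betw e A (e ` A)" by (rule inj_on_imp_bij_betw)
  then have "(card_of (e ` A), card_of A) \<in> ordIso"
    using card_of_ordIso ordIso_symmetric by blast
  with less have "small_set TYPE('u) (e ` A)"
    unfolding small_set_def by (rule ordIso_ordLess_trans[rotated])
  with e that show thesis by blast
qed

text \<open>
  Cocompleteness only speaks about shapes with objects and arrows in \<open>'u\<close>, so the shape \<open>C\<close> is
  first replaced by an isomorphic copy \<open>J\<close> inside \<open>'u\<close>.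
\<close>

lemma cocomplete_has_colimit:
  fixes C :: "('co, 'ca) category"
  assumes coc: "cocomplete TYPE('u) D" and small: "small_category TYPE('u) C"
    and F: "cat_functor C D F"
  shows "\<exists>Y \<mu>. is_colimit C D F Y \<mu>"
proof -
  interpret F: cat_functor C D F by fact
  have "small_set TYPE('u) (Obj C)" "small_set TYPE('u) (Arr C)"
    using small by (auto simp: small_category_def)
  then obtain e :: "'co \<Rightarrow> 'u" and a :: "'ca \<Rightarrow> 'u"
    where e: "inj_on e (Obj C)" "small_set TYPE('u) (e ` Obj C)"
      and a: "inj_on a (Arr C)" "small_set TYPE('u) (a ` Arr C)"
    using small_set_inj by metis
  define e' where "e' = inv_into (Obj C) e"
  define a' where "a' = inv_into (Arr C) a"
  have e'[simp]: "e' (e x) = x" if "x \<in> Obj C" for x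
    using e that by (simp add: e'_def)
  have a'[simp]: "a' (a x) = x" if "x \<in> Arr C" for x
    using a that by (simp add: a'_def)
  define J :: "('u, 'u) category" where
    "J = \<lparr>Obj = e ` Obj C, Arr = a ` Arr C, Dom = (\<lambda>f. e (Dom C (a' f))),
      Cod = (\<lambda>f. e (Cod C (a' f))), Ide = (\<lambda>x. a (Ide C (e' x))),
      Comp = (\<lambda>g f. a (a' g \<cdot>\<^bsub>C\<^esub> a' f))\<rparr>"
  define G :: "('u, 'u, _, _) cat_map" where
    "G = \<lparr>on_Obj = (\<lambda>x. on_Obj F (e' x)), on_Arr = (\<lambda>f. on_Arr F (a' f))\<rparr>"
  have J_simps: "Obj J = e ` Obj C" "Arr J = a ` Arr C" "Dom J f = e (Dom C (a' f))"
    "Cod J f = e (Cod C (a' f))" "Ide J x = a (Ide C (e' x))" "g \<cdot>\<^bsub>J\<^esub> f = a (a' g \<cdot>\<^bsub>C\<^esub> a' f)"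
    for f g x by (auto simp: J_def)
  have G_simps: "on_Obj G x = on_Obj F (e' x)" "on_Arr G f = on_Arr F (a' f)" for x f
    by (auto simp: G_def)
  have HomJ: "\<exists>f0. f0 \<in> Hom C (e' x) (e' y) \<and> f = a f0 \<and> a' f = f0 \<and>
      x = e (e' x) \<and> y = e (e' y)" if "f \<in> Hom J x y" for f x y
    using that by (auto simp: Hom_def J_simps F.C.Dom_in_Obj F.C.Cod_in_Obj)
  have HomJ_I: "a f \<in> Hom J (e x) (e y)" if "f \<in> Hom C x y" for f x y
    using that by (auto simp: Hom_def J_simps)
  have catJ: "category J"
  proof
    fix f g x y z assume "f \<in> Hom J x y" "g \<in> Hom J y z"
    then show "g \<cdot>\<^bsub>J\<^esub> f \<in> Hom J x z"
      using HomJ F.C.Comp_in_Hom HomJ_I J_simps(6) by metis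
  next
    fix f g h x y z w assume "f \<in> Hom J x y" "g \<in> Hom J y z" "h \<in> Hom J z w"
    then obtain f0 g0 h0 where
      0: "f0 \<in> Hom C (e' x) (e' y)" "g0 \<in> Hom C (e' y) (e' z)" "h0 \<in> Hom C (e' z) (e' w)"
      and eq: "a' f = f0" "a' g = g0" "a' h = h0" using HomJ by metis
    \<comment> \<open>\<open>a'\<close> inverts \<open>a\<close> only on \<open>Arr C\<close>, so
      the inner composites have to be known as arrows before the encoding cancels.\<close>
    have "g0 \<cdot>\<^bsub>C\<^esub> f0 \<in> Arr C" "h0 \<cdot>\<^bsub>C\<^esub> g0 \<in> Arr C"
      using F.C.Comp_in_Hom[OF 0(1,2)] F.C.Comp_in_Hom[OF 0(2,3)] HomD(1) by fast+
    then show "h \<cdot>\<^bsub>J\<^esub> g \<cdot>\<^bsub>J\<^esub> f = h \<cdot>\<^bsub>J\<^esub> (g \<cdot>\<^bsub>J\<^esub> f)"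
      using F.C.Comp_assoc[OF 0] by (simp add: J_simps eq)
  next
    fix x assume "x \<in> Obj J"
    then obtain y where y: "y \<in> Obj C" "x = e y" by (auto simp: J_simps)
    show "Ide J x \<in> Hom J x x"
      using HomJ_I[OF F.C.Ide_in_Hom[OF y(1)]] y by (simp add: J_simps)
  next
    fix f assume "f \<in> Arr J"
    then obtain g where g: "g \<in> Arr C" "f = a g" by (auto simp: J_simps)
    have "Ide C (Dom C g) \<in> Arr C" "Ide C (Cod C g) \<in> Arr C"
      using F.C.Ide_in_Hom[OF F.C.Dom_in_Obj[OF g(1)]] F.C.Ide_in_Hom[OF F.C.Cod_in_Obj[OF g(1)]]
      by (auto simp: Hom_def)
    then show "f \<cdot>\<^bsub>J\<^esub> Ide J (Dom J f) = f" "Ide J (Cod J f) \<cdot>\<^bsub>J\<^esub> f = f"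
      using g by (simp_all add: J_simps F.C.Dom_in_Obj F.C.Cod_in_Obj F.C.Comp_Ide F.C.Ide_Comp)
  qed (auto simp: J_simps F.C.Dom_in_Obj F.C.Cod_in_Obj)
  then interpret J: category J .
  have funG: "cat_functor J D G"
  proof
    fix f x y assume "f \<in> Hom J x y"
    then show "on_Arr G f \<in> Hom D (on_Obj G x) (on_Obj G y)"
      using HomJ F.on_Arr_in_Hom by (metis G_simps)
  next
    fix f g x y z assume "f \<in> Hom J x y" "g \<in> Hom J y z"
    then obtain f0 g0 where 0: "f0 \<in> Hom C (e' x) (e' y)" "g0 \<in> Hom C (e' y) (e' z)"
      and eq: "a' f = f0" "a' g = g0" using HomJ by metis
    show "on_Arr G (g \<cdot>\<^bsub>J\<^esub> f) = on_Arr G g \<cdot>\<^bsub>D\<^esub> on_Arr G f"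
      using F.on_Arr_Comp[OF 0] HomD(1)[OF F.C.Comp_in_Hom[OF 0]] by (simp add: G_simps J_simps eq)
  next
    fix x assume "x \<in> Obj J"
    then obtain y where y: "y \<in> Obj C" "x = e y" by (auto simp: J_simps)
    show "on_Arr G (Ide J x) = Ide D (on_Obj G x)"
      using y F.on_Arr_Ide[of y] HomD(1)[OF F.C.Ide_in_Hom[OF y(1)]]
      by (simp add: J_simps G_simps)
  qed (auto simp: J_simps G_simps F.on_Obj_in_Obj)
  \<comment> \<open>Reindexing along \<open>e\<close> identifies cocones on the copy with cocones on
    the original diagram, vertex unchanged. The universal property can therefore be read off from
    \<open>J\<close>.\<close>
  have cocone_JC: "cocone J D G Z \<theta> \<longleftrightarrow> cocone C D F Z (\<lambda>c. \<theta> (e c))" for Z \<theta>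
    unfolding cocone_iff[OF funG] cocone_iff[OF F] by (simp add: J_simps G_simps)
  have "small_category TYPE('u) J"
    using catJ e(2) a(2) by (simp add: small_category_def J_simps)
  with coc funG obtain Y \<mu> where Y: "is_colimit J D G Y \<mu>"
    unfolding cocomplete_def by blast
  have "is_colimit C D F Y (\<lambda>c. \<mu> (e c))"
    unfolding is_colimit_def
  proof (intro conjI allI impI)
    show "cocone C D F Y (\<lambda>c. \<mu> (e c))"
      using Y by (simp add: is_colimit_def cocone_JC)
  next
    fix Z \<theta> assume "cocone C D F Z \<theta>"
    \<comment> \<open>Conversely a cocone on \<open>F\<close> is pulled back along the decoding
      \<open>e'\<close>; on \<open>e c\<close> it returns \<theta> at \<open>c\<close>.\<close>
    then have "cocone J D G Z (\<theta> \<circ> e')"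
      unfolding cocone_JC cocone_iff[OF F] by (simp add: F.C.Dom_in_Obj F.C.Cod_in_Obj)
    then have "\<exists>!h. h \<in> Hom D Y Z \<and> (\<forall>x\<in>Obj J. h \<cdot>\<^bsub>D\<^esub> \<mu> x = (\<theta> \<circ> e') x)"
      using Y unfolding is_colimit_def by blast
    then show "\<exists>!h. h \<in> Hom D Y Z \<and> (\<forall>c\<in>Obj C. h \<cdot>\<^bsub>D\<^esub> \<mu> (e c) = \<theta> c)"
      by (simp add: J_simps)
  qed
  then show ?thesis by blast
qed

section \<open>Fibres and factorization through cartesian and cocartesian morphisms\<close>

lemma fibre_simps [simp]:
  "A \<in> Obj (fibre X B \<Phi> I) \<longleftrightarrow> A \<in> Obj X \<and> on_Obj \<Phi> A = I"
  "f \<in> Arr (fibre X B \<Phi> I) \<longleftrightarrow> f \<in> Arr X \<and> on_Arr \<Phi> f = Ide B I"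
  "Dom (fibre X B \<Phi> I) = Dom X" "Cod (fibre X B \<Phi> I) = Cod X" "Ide (fibre X B \<Phi> I) = Ide X"
  "Comp (fibre X B \<Phi> I) = Comp X"
  by (auto simp: fibre_def)

lemma Hom_fibre [simp]:
  "f \<in> Hom (fibre X B \<Phi> I) a b \<longleftrightarrow> f \<in> Hom X a b \<and> on_Arr \<Phi> f = Ide B I"
  by (auto simp: Hom_def)

context cat_functor
begin

text \<open>The universal property in hom-set form: the domain and codomain conditions become
  typings of \<theta> and \<open>u\<close>, which is how the data arise below.\<close>

lemma cocartesian_fill:
  assumes "cocartesian C D F \<psi>" "\<psi> \<in> Hom C a b" "\<theta> \<in> Hom C a z"
    "u \<in> Hom D (on_Obj F b) (on_Obj F z)" "on_Arr F \<theta> = u \<cdot>\<^bsub>D\<^esub> on_Arr F \<psi>"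
  shows "\<exists>!\<phi>. \<phi> \<in> Hom C b z \<and> on_Arr F \<phi> = u \<and> \<phi> \<cdot>\<^bsub>C\<^esub> \<psi> = \<theta>"
proof -
  have "\<exists>!\<phi>. \<phi> \<in> Hom C (Cod C \<psi>) (Cod C \<theta>) \<and> on_Arr F \<phi> = u \<and> \<theta> = \<phi> \<cdot>\<^bsub>C\<^esub> \<psi>"
    using assms HomD[OF assms(2)] HomD[OF assms(3)] HomD[OF assms(4)]
      HomD[OF on_Arr_in_Hom[OF assms(2)]]
    unfolding cocartesian_def by metis
  then show ?thesis
    using HomD[OF assms(2)] HomD[OF assms(3)] by (simp add: eq_commute[of \<theta>])
qed

lemma cartesian_fill:
  assumes "cartesian C D F \<kappa>" "\<kappa> \<in> Hom C w z" "\<theta> \<in> Hom C a z"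
    "v \<in> Hom D (on_Obj F a) (on_Obj F w)" "on_Arr F \<theta> = on_Arr F \<kappa> \<cdot>\<^bsub>D\<^esub> v"
  shows "\<exists>!\<psi>. \<psi> \<in> Hom C a w \<and> on_Arr F \<psi> = v \<and> \<kappa> \<cdot>\<^bsub>C\<^esub> \<psi> = \<theta>"
proof -
  have "\<exists>!\<psi>. \<psi> \<in> Hom C (Dom C \<theta>) (Dom C \<kappa>) \<and> on_Arr F \<psi> = v \<and> \<theta> = \<kappa> \<cdot>\<^bsub>C\<^esub> \<psi>"
    using assms HomD[OF assms(2)] HomD[OF assms(3)] HomD[OF assms(4)]
      HomD[OF on_Arr_in_Hom[OF assms(2)]]
    unfolding cartesian_def by metis
  then show ?thesis
    using HomD[OF assms(2)] HomD[OF assms(3)] by (simp add: eq_commute[of \<theta>])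
qed

text \<open>The case of \<open>cartesian_fill\<close> where the prescribed base morphism is the
  identity of \<open>I\<close>, so that the lift is an arrow of the fibre.\<close>

lemma cartesian_fill_fibre:
  assumes "cartesian C D F \<kappa>" "\<kappa> \<in> Hom C w z" "\<theta> \<in> Hom C a z"
    "on_Arr F \<theta> = on_Arr F \<kappa>" "a \<in> Obj C" "on_Obj F a = I" "on_Obj F w = I"
  shows "\<exists>!\<psi>. \<psi> \<in> Hom (fibre C D F I) a w \<and> \<kappa> \<cdot>\<^bsub>C\<^esub> \<psi> = \<theta>"
proof -
  have "Ide D I \<in> Hom D I I"
    using D.Ide_in_Hom on_Obj_in_Obj assms(5,6) by blast
  moreover have "on_Arr F \<kappa> \<cdot>\<^bsub>D\<^esub> Ide D I = on_Arr F \<kappa>"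
    using D.Comp_Ide_Hom on_Arr_in_Hom assms(2,7) by blast
  ultimately show ?thesis
    using cartesian_fill[OF assms(1-3), of "Ide D I"] assms(4,6,7) by simp
qed

text \<open>First \<theta> is extended along the cocartesian \<psi> to a \<phi> over the image of
  \<kappa>; then \<phi> is lifted through the cartesian \<kappa> over the identity. Uniqueness
  passes through both stages.\<close>

lemma cocartesian_cartesian_fill:
  assumes \<psi>: "cocartesian C D F \<psi>" "\<psi> \<in> Hom C a b" and \<kappa>: "cartesian C D F \<kappa>" "\<kappa> \<in> Hom C w z"
    and \<theta>: "\<theta> \<in> Hom C a z" "on_Arr F \<theta> = on_Arr F \<kappa> \<cdot>\<^bsub>D\<^esub> on_Arr F \<psi>"
    and I: "on_Obj F b = I" "on_Obj F w = I"
  shows "\<exists>!\<rho>. \<rho> \<in> Hom (fibre C D F I) b w \<and> \<kappa> \<cdot>\<^bsub>C\<^esub> (\<rho> \<cdot>\<^bsub>C\<^esub> \<psi>) = \<theta>"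
proof -
  have b: "b \<in> Obj C"
    using \<psi>(2) C.Cod_in_Obj by (auto simp: Hom_def)
  have Kh: "on_Arr F \<kappa> \<in> Hom D I (on_Obj F z)"
    using on_Arr_in_Hom[OF \<kappa>(2)] I by simp
  have ex: "\<exists>!\<phi>. \<phi> \<in> Hom C b z \<and> on_Arr F \<phi> = on_Arr F \<kappa> \<and> \<phi> \<cdot>\<^bsub>C\<^esub> \<psi> = \<theta>"
    using cocartesian_fill[OF \<psi> \<theta>(1) _ \<theta>(2)] Kh I by simp
  then obtain \<phi> where \<phi>: "\<phi> \<in> Hom C b z" "on_Arr F \<phi> = on_Arr F \<kappa>" "\<phi> \<cdot>\<^bsub>C\<^esub> \<psi> = \<theta>" by blast
  have ex': "\<exists>!\<rho>. \<rho> \<in> Hom (fibre C D F I) b w \<and> \<kappa> \<cdot>\<^bsub>C\<^esub> \<rho> = \<phi>"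
    by (rule cartesian_fill_fibre[OF \<kappa> \<phi>(1,2) b I])
  \<comment> \<open>For an arrow \<rho> of the fibre, the composite of \<kappa> with \<rho> lies
    over the image of \<kappa>. It is thus a candidate for \<phi>, and uniqueness of \<phi> makes
    the two equations equivalent.\<close>
  have "\<kappa> \<cdot>\<^bsub>C\<^esub> (\<rho> \<cdot>\<^bsub>C\<^esub> \<psi>) = \<theta> \<longleftrightarrow> \<kappa> \<cdot>\<^bsub>C\<^esub> \<rho> = \<phi>" if \<rho>: "\<rho> \<in> Hom (fibre C D F I) b w" for \<rho>
  proof -
    have \<rho>': "\<rho> \<in> Hom C b w" "on_Arr F \<rho> = Ide D I" using \<rho> by auto
    have "on_Arr F (\<kappa> \<cdot>\<^bsub>C\<^esub> \<rho>) = on_Arr F \<kappa>"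
      using on_Arr_Comp[OF \<rho>'(1) \<kappa>(2)] \<rho>'(2) D.Comp_Ide_Hom[OF Kh] by simp
    moreover have "\<kappa> \<cdot>\<^bsub>C\<^esub> \<rho> \<in> Hom C b z" by (rule C.Comp_in_Hom[OF \<rho>'(1) \<kappa>(2)])
    ultimately show ?thesis
      using C.Comp_assoc[OF \<psi>(2) \<rho>'(1) \<kappa>(2)] ex \<phi> by metis
  qed
  with ex' show ?thesis by metis
qed

end

section \<open>Moving the diagram into the fibre over the base colimit\<close>

text \<open>The situation after stages (i) and (ii): a colimit of the base diagram together with
  chosen cocartesian lifts of its cocone. Stages (iii) and (iv) are carried out inside this
  context.\<close>

locale cocartesian_diagram = T: cat_functor C X T + \<Phi>: cat_functor X B \<Phi>
  for C :: "('co, 'ca) category" and X :: "('xo, 'xa) category" and B :: "('bo, 'ba) category"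
    and T :: "('co, 'ca, 'xo, 'xa) cat_map" and \<Phi> :: "('xo, 'xa, 'bo, 'ba) cat_map" +
  fixes I :: 'bo and \<gamma> :: "'co \<Rightarrow> 'ba" and X\<^sub>0 :: "'co \<Rightarrow> 'xo" and \<gamma>' :: "'co \<Rightarrow> 'xa"
  assumes colimit_base: "is_colimit C B (comp_map \<Phi> T) I \<gamma>"
    and choice: "cocartesian_choice X B \<Phi> C T I \<gamma> X\<^sub>0 \<gamma>'"
begin

lemma functor_base: "cat_functor C B (comp_map \<Phi> T)"
  by (rule cat_functor_comp_map[OF T.cat_functor_axioms \<Phi>.cat_functor_axioms])

lemma cocone_base:
  shows I_in_Obj: "I \<in> Obj B"
    and \<gamma>_in_Hom: "c \<in> Obj C \<Longrightarrow> \<gamma> c \<in> Hom B (on_Obj \<Phi> (on_Obj T c)) I"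
    and \<gamma>_natural: "f \<in> Arr C \<Longrightarrow> \<gamma> (Cod C f) \<cdot>\<^bsub>B\<^esub> on_Arr \<Phi> (on_Arr T f) = \<gamma> (Dom C f)"
  using colimit_base unfolding is_colimit_def cocone_iff[OF functor_base]
  by (auto simp: comp_map_def)

lemma choiceD:
  assumes "c \<in> Obj C"
  shows "X\<^sub>0 c \<in> Obj X" "on_Obj \<Phi> (X\<^sub>0 c) = I" "\<gamma>' c \<in> Hom X (on_Obj T c) (X\<^sub>0 c)"
    "on_Arr \<Phi> (\<gamma>' c) = \<gamma> c" "cocartesian X B \<Phi> (\<gamma>' c)"
  using choice assms by (auto simp: cocartesian_choice_def)

lemma category_fibre_I: "category (fibre X B \<Phi> I)"
  by (rule category_fibre[OF \<Phi>.cat_functor_axioms I_in_Obj])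

text \<open>By naturality of \<gamma>, the composite of \<open>T f\<close> with
  \<open>\<gamma>' c'\<close> lies over \<open>\<gamma> c\<close>, that is, over
  \<open>\<gamma> c\<close> followed by the identity of \<open>I\<close>. Since
  \<open>\<gamma>' c\<close> is cocartesian, it factors uniquely through \<open>\<gamma>' c\<close>
  by an arrow of the fibre.\<close>

lemma ex1_transition:
  assumes f: "f \<in> Hom C c c'"
  shows "\<exists>!g. g \<in> Hom (fibre X B \<Phi> I) (X\<^sub>0 c) (X\<^sub>0 c') \<and> g \<cdot>\<^bsub>X\<^esub> \<gamma>' c = \<gamma>' c' \<cdot>\<^bsub>X\<^esub> on_Arr T f"
proof -
  have c: "c \<in> Obj C" "c' \<in> Obj C" using f T.C.Dom_in_Obj T.C.Cod_in_Obj by (auto simp: Hom_def)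
  have Tf: "on_Arr T f \<in> Hom X (on_Obj T c) (on_Obj T c')" by (rule T.on_Arr_in_Hom[OF f])
  have "on_Arr \<Phi> (\<gamma>' c' \<cdot>\<^bsub>X\<^esub> on_Arr T f) = Ide B I \<cdot>\<^bsub>B\<^esub> on_Arr \<Phi> (\<gamma>' c)"
    using \<Phi>.on_Arr_Comp[OF Tf choiceD(3)[OF c(2)]] \<gamma>_natural[of f] HomD[OF f] choiceD(4) c
      \<Phi>.D.Ide_Comp_Hom[OF \<gamma>_in_Hom] by simp
  then show ?thesis
    using \<Phi>.cocartesian_fill[OF choiceD(5,3)[OF c(1)] T.D.Comp_in_Hom[OF Tf choiceD(3)[OF c(2)]],
        of "Ide B I"] \<Phi>.D.Ide_in_Hom[OF I_in_Obj] choiceD(2) c by simp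
qed

text \<open>The arrow part is forced by \<open>ex1_transition\<close>. Its uniqueness clause also
  gives functoriality, since composites and identities satisfy the equation that characterizes the
  transition arrow.\<close>

lemma ex_fibre_functor: "\<exists>F. fibre_functor X B \<Phi> C T I X\<^sub>0 \<gamma>' F"
proof -
  interpret R: category "fibre X B \<Phi> I" by (rule category_fibre_I)
  \<comment> \<open>The endpoints are recovered from \<open>f\<close> because the arrow part of a
    functor takes only the arrow as argument. The description is meaningful for \<open>f\<close> in
    \<open>Arr C\<close>; elsewhere the value is irrelevant.\<close>
  define t where "t f = (THE g. g \<in> Hom (fibre X B \<Phi> I) (X\<^sub>0 (Dom C f)) (X\<^sub>0 (Cod C f)) \<and>
    g \<cdot>\<^bsub>X\<^esub> \<gamma>' (Dom C f) = \<gamma>' (Cod C f) \<cdot>\<^bsub>X\<^esub> on_Arr T f)" for f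
  have t: "t f \<in> Hom (fibre X B \<Phi> I) (X\<^sub>0 c) (X\<^sub>0 c')" "t f \<cdot>\<^bsub>X\<^esub> \<gamma>' c = \<gamma>' c' \<cdot>\<^bsub>X\<^esub> on_Arr T f"
    if "f \<in> Hom C c c'" for f c c'
    using theI'[OF ex1_transition[OF that]] HomD[OF that] by (simp_all add: t_def)
  have t_eq: "t f = g" if "f \<in> Hom C c c'" "g \<in> Hom (fibre X B \<Phi> I) (X\<^sub>0 c) (X\<^sub>0 c')"
    "g \<cdot>\<^bsub>X\<^esub> \<gamma>' c = \<gamma>' c' \<cdot>\<^bsub>X\<^esub> on_Arr T f" for f c c' g
    using ex1_transition[OF that(1)] t[OF that(1)] that(2,3) by blast
  define F where "F = \<lparr>on_Obj = X\<^sub>0, on_Arr = t\<rparr>"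
  have F: "cat_functor C (fibre X B \<Phi> I) F"
  proof
    fix f g a b c assume f: "f \<in> Hom C a b" and g: "g \<in> Hom C b c"
    have o: "a \<in> Obj C" "b \<in> Obj C" "c \<in> Obj C"
      using f g T.C.Dom_in_Obj T.C.Cod_in_Obj by (auto simp: Hom_def)
    have h: "t f \<in> Hom X (X\<^sub>0 a) (X\<^sub>0 b)" "t g \<in> Hom X (X\<^sub>0 b) (X\<^sub>0 c)" using t(1) f g by auto
    \<comment> \<open>Pasting the naturality squares of \<open>f\<close> and \<open>g\<close> shows
      that the composite of the two transitions solves the problem defining the transition of the
      composite.\<close>
    have "(t g \<cdot>\<^bsub>X\<^esub> t f) \<cdot>\<^bsub>X\<^esub> \<gamma>' a = t g \<cdot>\<^bsub>X\<^esub> (\<gamma>' b \<cdot>\<^bsub>X\<^esub> on_Arr T f)"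
      using T.D.Comp_assoc[OF choiceD(3)[OF o(1)] h] t(2)[OF f] by simp
    also have "\<dots> = (\<gamma>' c \<cdot>\<^bsub>X\<^esub> on_Arr T g) \<cdot>\<^bsub>X\<^esub> on_Arr T f"
      using T.D.Comp_assoc[OF T.on_Arr_in_Hom[OF f] choiceD(3)[OF o(2)] h(2)] t(2)[OF g] by simp
    also have "\<dots> = \<gamma>' c \<cdot>\<^bsub>X\<^esub> on_Arr T (g \<cdot>\<^bsub>C\<^esub> f)"
      using T.D.Comp_assoc[OF T.on_Arr_in_Hom[OF f] T.on_Arr_in_Hom[OF g] choiceD(3)[OF o(3)]]
        T.on_Arr_Comp[OF f g] by simp
    finally show "on_Arr F (g \<cdot>\<^bsub>C\<^esub> f) = on_Arr F g \<cdot>\<^bsub>fibre X B \<Phi> I\<^esub> on_Arr F f"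
      using t_eq[OF T.C.Comp_in_Hom[OF f g] R.Comp_in_Hom[OF t(1)[OF f] t(1)[OF g]]]
      by (simp add: F_def)
  next
    fix a assume a: "a \<in> Obj C"
    have "Ide X (X\<^sub>0 a) \<cdot>\<^bsub>X\<^esub> \<gamma>' a = \<gamma>' a \<cdot>\<^bsub>X\<^esub> on_Arr T (Ide C a)"
      using T.on_Arr_Ide[OF a] T.D.Ide_Comp_Hom T.D.Comp_Ide_Hom choiceD(3)[OF a] by metis
    then show "on_Arr F (Ide C a) = Ide (fibre X B \<Phi> I) (on_Obj F a)"
      using t_eq[OF T.C.Ide_in_Hom[OF a] R.Ide_in_Hom[of "X\<^sub>0 a"]] choiceD(1,2)[OF a]
      by (simp add: F_def)
  qed (use t(1) choiceD in \<open>auto simp: F_def\<close>)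
  \<comment> \<open>The same data viewed in the total category, because the naturality of
    \<open>\<gamma>'\<close> is a statement about functors into \<open>X\<close>.\<close>
  have "cat_functor C X F"
  proof -
    interpret F: cat_functor C "fibre X B \<Phi> I" F by fact
    show ?thesis
      using F.on_Obj_in_Obj F.on_Arr_in_Hom F.on_Arr_Ide F.on_Arr_Comp by unfold_locales auto
  qed
  then interpret F: cat_functor C X F .
  have "nat_trans C X T F \<gamma>'"
    by unfold_locales (use t(2) choiceD(3) in \<open>auto simp: F_def\<close>)
  with F show ?thesis by (auto simp: fibre_functor_def F_def)
qed

text \<open>Existence: a cocone on \<open>T\<close> is mediated by \<kappa> after the arrow
  \<open>Y \<rightarrow> W\<close> that the fibre colimit provides. Uniqueness: a mediating
  \<open>h\<close> must lie over \<open>u\<close>, because its image mediates in the base; hence it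
  factors through \<kappa> by an arrow of the fibre, and that arrow is determined by the fibre
  colimit.\<close>

lemma colimit_total:
  assumes fib: "fibration X B \<Phi>" and ff: "fibre_functor X B \<Phi> C T I X\<^sub>0 \<gamma>' F"
    and colim: "is_colimit C (fibre X B \<Phi> I) F Y \<mu>"
  shows "is_colimit C X T Y (\<lambda>c. \<mu> c \<cdot>\<^bsub>X\<^esub> \<gamma>' c)"
proof -
  interpret R: category "fibre X B \<Phi> I" by (rule category_fibre_I)
  have F: "cat_functor C (fibre X B \<Phi> I) F" and F0: "\<And>c. c \<in> Obj C \<Longrightarrow> on_Obj F c = X\<^sub>0 c"
    and nt: "nat_trans C X T F \<gamma>'"
    using ff by (auto simp: fibre_functor_def)
  interpret F: cat_functor C "fibre X B \<Phi> I" F by fact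
  interpret n: nat_trans C X T F \<gamma>' by fact
  have Y: "Y \<in> Obj X" "on_Obj \<Phi> Y = I"
    and \<mu>F: "\<And>c. c \<in> Obj C \<Longrightarrow> \<mu> c \<in> Hom (fibre X B \<Phi> I) (X\<^sub>0 c) Y"
    and \<mu>n: "\<And>f. f \<in> Arr C \<Longrightarrow> \<mu> (Cod C f) \<cdot>\<^bsub>X\<^esub> on_Arr F f = \<mu> (Dom C f)"
    using colim F0 unfolding is_colimit_def cocone_iff[OF F] by auto
  have \<mu>: "\<mu> c \<in> Hom X (X\<^sub>0 c) Y" "on_Arr \<Phi> (\<mu> c) = Ide B I" if "c \<in> Obj C" for c
    using \<mu>F[OF that] by auto
  note \<gamma>' = choiceD(3)
  have nat: "\<gamma>' (Cod C f) \<cdot>\<^bsub>X\<^esub> on_Arr T f = on_Arr F f \<cdot>\<^bsub>X\<^esub> \<gamma>' (Dom C f)" if "f \<in> Arr C" for f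
    using n.natural[OF Arr_in_Hom[OF that]] .
  have Ff: "on_Arr F f \<in> Hom (fibre X B \<Phi> I) (X\<^sub>0 (Dom C f)) (X\<^sub>0 (Cod C f))" if "f \<in> Arr C" for f
    using F.on_Arr_in_Hom[OF Arr_in_Hom[OF that]] F0 T.C.Dom_in_Obj T.C.Cod_in_Obj that by simp
  have \<mu>\<gamma>': "\<mu> c \<cdot>\<^bsub>X\<^esub> \<gamma>' c \<in> Hom X (on_Obj T c) Y" if "c \<in> Obj C" for c
    by (rule T.D.Comp_in_Hom[OF \<gamma>'[OF that] \<mu>(1)[OF that]])
  \<comment> \<open>The candidate cocone lies over the base cocone \<gamma>; this later identifies
    the image of any mediating morphism with \<open>u\<close>.\<close>
  have over: "on_Arr \<Phi> (\<mu> c \<cdot>\<^bsub>X\<^esub> \<gamma>' c) = \<gamma> c" if "c \<in> Obj C" for c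
    using \<Phi>.on_Arr_Comp[OF \<gamma>'[OF that] \<mu>(1)[OF that]] \<mu>(2)[OF that] choiceD(4)[OF that]
      \<Phi>.D.Ide_Comp_Hom[OF \<gamma>_in_Hom[OF that]] by simp
  show ?thesis
    unfolding is_colimit_def
  proof (intro conjI allI impI)
    have "(\<mu> (Cod C f) \<cdot>\<^bsub>X\<^esub> \<gamma>' (Cod C f)) \<cdot>\<^bsub>X\<^esub> on_Arr T f = \<mu> (Dom C f) \<cdot>\<^bsub>X\<^esub> \<gamma>' (Dom C f)"
      if f: "f \<in> Arr C" for f
    proof -
      note o = T.C.Dom_in_Obj[OF f] T.C.Cod_in_Obj[OF f]
      have "on_Arr F f \<in> Hom X (X\<^sub>0 (Dom C f)) (X\<^sub>0 (Cod C f))" using Ff[OF f] by simp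
      from T.D.Comp_assoc[OF \<gamma>'[OF o(1)] this \<mu>(1)[OF o(2)]]
        T.D.Comp_assoc[OF T.on_Arr_in_Hom[OF Arr_in_Hom[OF f]] \<gamma>'[OF o(2)] \<mu>(1)[OF o(2)]]
      show ?thesis using nat[OF f] \<mu>n[OF f] by simp
    qed
    then show "cocone C X T Y (\<lambda>c. \<mu> c \<cdot>\<^bsub>X\<^esub> \<gamma>' c)"
      unfolding cocone_iff[OF T.cat_functor_axioms] using Y \<mu>\<gamma>' by simp
  next
    fix Z \<theta> assume Z\<theta>: "cocone C X T Z \<theta>"
    have Z: "Z \<in> Obj X" and \<theta>: "\<And>c. c \<in> Obj C \<Longrightarrow> \<theta> c \<in> Hom X (on_Obj T c) Z"
      and \<theta>n: "\<And>f. f \<in> Arr C \<Longrightarrow> \<theta> (Cod C f) \<cdot>\<^bsub>X\<^esub> on_Arr T f = \<theta> (Dom C f)"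
      using Z\<theta> unfolding cocone_iff[OF T.cat_functor_axioms] by auto
    have "cocone C B (comp_map \<Phi> T) (on_Obj \<Phi> Z) (\<lambda>c. on_Arr \<Phi> (\<theta> c))"
      by (rule cocone_comp_map[OF T.cat_functor_axioms \<Phi>.cat_functor_axioms Z\<theta>])
    then have ex1_u: "\<exists>!u. u \<in> Hom B I (on_Obj \<Phi> Z) \<and> (\<forall>c\<in>Obj C. u \<cdot>\<^bsub>B\<^esub> \<gamma> c = on_Arr \<Phi> (\<theta> c))"
      using colimit_base unfolding is_colimit_def by blast
    then obtain u where u: "u \<in> Hom B I (on_Obj \<Phi> Z)"
      and u\<gamma>: "\<And>c. c \<in> Obj C \<Longrightarrow> u \<cdot>\<^bsub>B\<^esub> \<gamma> c = on_Arr \<Phi> (\<theta> c)" by blast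
    obtain \<kappa> where cart: "cartesian X B \<Phi> \<kappa>" and \<kappa>Z: "Cod X \<kappa> = Z" and \<kappa>u: "on_Arr \<Phi> \<kappa> = u"
      using fib Z HomD[OF u] unfolding fibration_def by metis
    define W where "W = Dom X \<kappa>"
    have \<kappa>: "\<kappa> \<in> Hom X W Z" using cart \<kappa>Z by (auto simp: cartesian_def Hom_def W_def)
    have W: "W \<in> Obj X" "on_Obj \<Phi> W = I"
      using HomD[OF \<kappa>] T.D.Dom_in_Obj \<Phi>.on_Arr_in_Hom[OF \<kappa>] HomD[OF u] \<kappa>u
      by (auto simp: Hom_def)
    have ex1_\<rho>: "\<exists>!\<rho>. \<rho> \<in> Hom (fibre X B \<Phi> I) (X\<^sub>0 c) W \<and> \<kappa> \<cdot>\<^bsub>X\<^esub> (\<rho> \<cdot>\<^bsub>X\<^esub> \<gamma>' c) = \<theta> c"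
      if c: "c \<in> Obj C" for c
      using \<Phi>.cocartesian_cartesian_fill[OF choiceD(5,3)[OF c] cart \<kappa> \<theta>[OF c] _ choiceD(2)[OF c] W(2)]
        u\<gamma>[OF c] choiceD(4)[OF c] \<kappa>u by simp
    then have "\<forall>c\<in>Obj C. \<exists>\<rho>. \<rho> \<in> Hom (fibre X B \<Phi> I) (X\<^sub>0 c) W \<and> \<kappa> \<cdot>\<^bsub>X\<^esub> (\<rho> \<cdot>\<^bsub>X\<^esub> \<gamma>' c) = \<theta> c"
      by blast
    from bchoice[OF this] obtain \<rho> where
      \<rho>: "\<And>c. c \<in> Obj C \<Longrightarrow> \<rho> c \<in> Hom (fibre X B \<Phi> I) (X\<^sub>0 c) W"
        "\<And>c. c \<in> Obj C \<Longrightarrow> \<kappa> \<cdot>\<^bsub>X\<^esub> (\<rho> c \<cdot>\<^bsub>X\<^esub> \<gamma>' c) = \<theta> c" by blast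
    have \<rho>_eq: "r = \<rho> c" if "c \<in> Obj C" "r \<in> Hom (fibre X B \<Phi> I) (X\<^sub>0 c) W"
      "\<kappa> \<cdot>\<^bsub>X\<^esub> (r \<cdot>\<^bsub>X\<^esub> \<gamma>' c) = \<theta> c" for r c
      using ex1_\<rho>[OF that(1)] \<rho>[OF that(1)] that(2,3) by blast
    \<comment> \<open>Compatibility of the family \<rho> is checked after precomposing with
      \<open>\<gamma>'\<close> and postcomposing with \<kappa>: both sides then give the component
      of \<theta> at \<open>Dom C f\<close>, and uniqueness of the middle factor concludes.\<close>
    have "\<rho> (Cod C f) \<cdot>\<^bsub>X\<^esub> on_Arr F f = \<rho> (Dom C f)" if f: "f \<in> Arr C" for f
    proof (rule \<rho>_eq)
      note o = T.C.Dom_in_Obj[OF f] T.C.Cod_in_Obj[OF f]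
      note Tf = T.on_Arr_in_Hom[OF Arr_in_Hom[OF f]]
      show "Dom C f \<in> Obj C" by fact
      show "\<rho> (Cod C f) \<cdot>\<^bsub>X\<^esub> on_Arr F f \<in> Hom (fibre X B \<Phi> I) (X\<^sub>0 (Dom C f)) W"
        using R.Comp_in_Hom[OF Ff[OF f] \<rho>(1)[OF o(2)]] by simp
      have h: "on_Arr F f \<in> Hom X (X\<^sub>0 (Dom C f)) (X\<^sub>0 (Cod C f))" "\<rho> (Cod C f) \<in> Hom X (X\<^sub>0 (Cod C f)) W"
        using Ff[OF f] \<rho>(1)[OF o(2)] by auto
      have "\<rho> (Cod C f) \<cdot>\<^bsub>X\<^esub> on_Arr F f \<cdot>\<^bsub>X\<^esub> \<gamma>' (Dom C f) =
          \<rho> (Cod C f) \<cdot>\<^bsub>X\<^esub> \<gamma>' (Cod C f) \<cdot>\<^bsub>X\<^esub> on_Arr T f"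
        using T.D.Comp_assoc[OF \<gamma>'[OF o(1)] h] T.D.Comp_assoc[OF Tf \<gamma>'[OF o(2)] h(2)] nat[OF f]
        by simp
      then show "\<kappa> \<cdot>\<^bsub>X\<^esub> (\<rho> (Cod C f) \<cdot>\<^bsub>X\<^esub> on_Arr F f \<cdot>\<^bsub>X\<^esub> \<gamma>' (Dom C f)) = \<theta> (Dom C f)"
        using T.D.Comp_assoc[OF Tf T.D.Comp_in_Hom[OF \<gamma>'[OF o(2)] h(2)] \<kappa>] \<rho>(2)[OF o(2)] \<theta>n[OF f]
        by simp
    qed
    then have "cocone C (fibre X B \<Phi> I) F W \<rho>"
      unfolding cocone_iff[OF F] using W \<rho>(1) F0 by simp
    then have ex1_k: "\<exists>!k. k \<in> Hom (fibre X B \<Phi> I) Y W \<and> (\<forall>c\<in>Obj C. k \<cdot>\<^bsub>X\<^esub> \<mu> c = \<rho> c)"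
      using colim unfolding is_colimit_def fibre_simps by blast
    \<comment> \<open>This translates mediation of \<theta> in \<open>X\<close> into mediation of
      \<rho> in the fibre, again by uniqueness of the middle factor. The forward direction serves
      uniqueness, the backward one existence.\<close>
    have key: "(\<kappa> \<cdot>\<^bsub>X\<^esub> k) \<cdot>\<^bsub>X\<^esub> (\<mu> c \<cdot>\<^bsub>X\<^esub> \<gamma>' c) = \<theta> c \<longleftrightarrow> k \<cdot>\<^bsub>X\<^esub> \<mu> c = \<rho> c"
      if k: "k \<in> Hom (fibre X B \<Phi> I) Y W" and c: "c \<in> Obj C" for k c
    proof -
      have kX: "k \<in> Hom X Y W" using k by simp
      have "k \<cdot>\<^bsub>X\<^esub> \<mu> c \<in> Hom (fibre X B \<Phi> I) (X\<^sub>0 c) W"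
        using R.Comp_in_Hom[OF \<mu>F[OF c] k] by simp
      moreover have "(\<kappa> \<cdot>\<^bsub>X\<^esub> k) \<cdot>\<^bsub>X\<^esub> (\<mu> c \<cdot>\<^bsub>X\<^esub> \<gamma>' c) = \<kappa> \<cdot>\<^bsub>X\<^esub> ((k \<cdot>\<^bsub>X\<^esub> \<mu> c) \<cdot>\<^bsub>X\<^esub> \<gamma>' c)"
        using T.D.Comp_assoc[OF \<mu>\<gamma>'[OF c] kX \<kappa>] T.D.Comp_assoc[OF \<gamma>'[OF c] \<mu>(1)[OF c] kX] by simp
      ultimately show ?thesis using \<rho>_eq[OF c] \<rho>(2)[OF c] by metis
    qed
    obtain k where k: "k \<in> Hom (fibre X B \<Phi> I) Y W" "\<forall>c\<in>Obj C. k \<cdot>\<^bsub>X\<^esub> \<mu> c = \<rho> c"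
      using ex1_k by blast
    show "\<exists>!h. h \<in> Hom X Y Z \<and> (\<forall>c\<in>Obj C. h \<cdot>\<^bsub>X\<^esub> (\<mu> c \<cdot>\<^bsub>X\<^esub> \<gamma>' c) = \<theta> c)"
    proof (rule ex1I[of _ "\<kappa> \<cdot>\<^bsub>X\<^esub> k"])
      show "\<kappa> \<cdot>\<^bsub>X\<^esub> k \<in> Hom X Y Z \<and> (\<forall>c\<in>Obj C. \<kappa> \<cdot>\<^bsub>X\<^esub> k \<cdot>\<^bsub>X\<^esub> (\<mu> c \<cdot>\<^bsub>X\<^esub> \<gamma>' c) = \<theta> c)"
        using k key[OF k(1)] T.D.Comp_in_Hom[OF _ \<kappa>, of k Y] by simp
    next
      fix h assume h: "h \<in> Hom X Y Z \<and> (\<forall>c\<in>Obj C. h \<cdot>\<^bsub>X\<^esub> (\<mu> c \<cdot>\<^bsub>X\<^esub> \<gamma>' c) = \<theta> c)"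
      then have hX: "h \<in> Hom X Y Z" by blast
      \<comment> \<open>The image of \<open>h\<close> solves the same mediation problem in the base
        as \<open>u\<close>, so the two coincide.\<close>
      have "on_Arr \<Phi> h \<cdot>\<^bsub>B\<^esub> \<gamma> c = on_Arr \<Phi> (\<theta> c)" if c: "c \<in> Obj C" for c
        using \<Phi>.on_Arr_Comp[OF \<mu>\<gamma>'[OF c] hX] over[OF c] h c by simp
      then have "on_Arr \<Phi> h = u"
        using ex1_u u u\<gamma> \<Phi>.on_Arr_in_Hom[OF hX] Y(2) by blast
      then obtain k' where k': "k' \<in> Hom (fibre X B \<Phi> I) Y W" "\<kappa> \<cdot>\<^bsub>X\<^esub> k' = h"
        using \<Phi>.cartesian_fill_fibre[OF cart \<kappa> hX _ Y W(2)] \<kappa>u by metis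
      then have "\<forall>c\<in>Obj C. k' \<cdot>\<^bsub>X\<^esub> \<mu> c = \<rho> c" using key[OF k'(1)] h by blast
      then have "k' = k" using ex1_k k k'(1) by blast
      with k'(2) show "h = \<kappa> \<cdot>\<^bsub>X\<^esub> k" by simp
    qed
  qed
qed

end

section \<open>Existence of cocartesian lifts, and all stages combined\<close>

lemma ex_cocartesian_choice:
  assumes cof: "cofibration X B \<Phi>" and T: "cat_functor C X T"
    and cocone: "cocone C B (comp_map \<Phi> T) I \<gamma>"
  shows "\<exists>X\<^sub>0 \<gamma>'. cocartesian_choice X B \<Phi> C T I \<gamma> X\<^sub>0 \<gamma>'"
proof -
  interpret \<Phi>: cat_functor X B \<Phi> using cof by (simp add: cofibration_def)
  interpret T: cat_functor C X T by fact
  have "\<exists>\<psi>. cocartesian X B \<Phi> \<psi> \<and> Dom X \<psi> = on_Obj T c \<and> on_Arr \<Phi> \<psi> = \<gamma> c \<and>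
      on_Obj \<Phi> (Cod X \<psi>) = I" if c: "c \<in> Obj C" for c
  proof -
    have g: "\<gamma> c \<in> Hom B (on_Obj \<Phi> (on_Obj T c)) I"
      using cocone c
      unfolding cocone_iff[OF cat_functor_comp_map[OF T \<Phi>.cat_functor_axioms]]
      by (simp add: comp_map_def)
    then obtain \<psi> where \<psi>: "cocartesian X B \<Phi> \<psi>" "Dom X \<psi> = on_Obj T c" "on_Arr \<Phi> \<psi> = \<gamma> c"
      using cof T.on_Obj_in_Obj[OF c] HomD[OF g] unfolding cofibration_def by metis
    then have "\<psi> \<in> Arr X" by (simp add: cocartesian_def)
    \<comment> \<open>The cofibration property prescribes only the domain and the image of the lift.
      That its codomain lies in the fibre over \<open>I\<close> follows from the codomain of
      \<open>\<gamma> c\<close>.\<close>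
    then have "on_Obj \<Phi> (Cod X \<psi>) = I"
      using HomD(3)[OF \<Phi>.on_Arr_in_Hom[OF Arr_in_Hom]] HomD(3)[OF g] \<psi>(3) by metis
    with \<psi> show ?thesis by blast
  qed
  then obtain \<gamma>' where \<gamma>': "\<forall>c\<in>Obj C. cocartesian X B \<Phi> (\<gamma>' c) \<and> Dom X (\<gamma>' c) = on_Obj T c \<and>
      on_Arr \<Phi> (\<gamma>' c) = \<gamma> c \<and> on_Obj \<Phi> (Cod X (\<gamma>' c)) = I"
    by metis
  \<comment> \<open>The objects \<open>X\<^sub>0 c\<close> are taken to be the codomains of the
    chosen lifts.\<close>
  then have "cocartesian_choice X B \<Phi> C T I \<gamma> (\<lambda>c. Cod X (\<gamma>' c)) \<gamma>'"
    using \<Phi>.C.Cod_in_Obj by (auto simp: cocartesian_choice_def cocartesian_def Hom_def)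
  then show ?thesis by blast
qed

text \<open>Each stage of the construction appears twice: some choice exists, and the next stage
  succeeds for every choice. So the recipe never gets stuck, and its outcome is a colimit whichever
  choices are made.\<close>

theorem theorem4p4:
  fixes X :: "('xo, 'xa) category"
    and B :: "('bo, 'ba) category"
    and \<Phi> :: "('xo, 'xa, 'bo, 'ba) cat_map"
    and C :: "('co, 'ca) category"
    and T :: "('co, 'ca, 'xo, 'xa) cat_map"
  assumes "fibration X B \<Phi>"
    and "cofibration X B \<Phi>"
    and "cocomplete TYPE('u) B"
    and "\<And>I. I \<in> Obj B \<Longrightarrow> cocomplete TYPE('u) (fibre X B \<Phi> I)"
    and "small_category TYPE('u) C"
    and "connected_category C"
    and "cat_functor C X T"
  shows "(\<exists>Y \<nu>. is_colimit C X T Y \<nu>) \<and>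
    (\<exists>I \<gamma>. is_colimit C B (comp_map \<Phi> T) I \<gamma>) \<and>
    (\<forall>I \<gamma>. is_colimit C B (comp_map \<Phi> T) I \<gamma> \<longrightarrow>
      (\<exists>X\<^sub>0 \<gamma>'. cocartesian_choice X B \<Phi> C T I \<gamma> X\<^sub>0 \<gamma>') \<and>
      (\<forall>X\<^sub>0 \<gamma>'. cocartesian_choice X B \<Phi> C T I \<gamma> X\<^sub>0 \<gamma>' \<longrightarrow>
        (\<exists>F. fibre_functor X B \<Phi> C T I X\<^sub>0 \<gamma>' F) \<and>
        (\<forall>F. fibre_functor X B \<Phi> C T I X\<^sub>0 \<gamma>' F \<longrightarrow>
          (\<exists>Y \<mu>. is_colimit C (fibre X B \<Phi> I) F Y \<mu>) \<and>
          (\<forall>Y \<mu>. is_colimit C (fibre X B \<Phi> I) F Y \<mu> \<longrightarrow>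
            is_colimit C X T Y (\<lambda>c. \<mu> c \<cdot>\<^bsub>X\<^esub> \<gamma>' c)))))"
proof -
  interpret \<Phi>: cat_functor X B \<Phi> using assms(1) by (simp add: fibration_def)
  interpret T: cat_functor C X T by fact
  have \<Phi>T: "cat_functor C B (comp_map \<Phi> T)"
    by (rule cat_functor_comp_map[OF assms(7) \<Phi>.cat_functor_axioms])
  have base: "\<exists>I \<gamma>. is_colimit C B (comp_map \<Phi> T) I \<gamma>"
    by (rule cocomplete_has_colimit[OF assms(3,5) \<Phi>T])
  have choice: "\<exists>X\<^sub>0 \<gamma>'. cocartesian_choice X B \<Phi> C T I \<gamma> X\<^sub>0 \<gamma>'"
    if "is_colimit C B (comp_map \<Phi> T) I \<gamma>" for I \<gamma>
    using ex_cocartesian_choice[OF assms(2,7)] that by (simp add: is_colimit_def)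
  have fibre_colimit: "\<exists>Y \<mu>. is_colimit C (fibre X B \<Phi> I) F Y \<mu>"
    if "is_colimit C B (comp_map \<Phi> T) I \<gamma>" "fibre_functor X B \<Phi> C T I X\<^sub>0 \<gamma>' F" for I \<gamma> X\<^sub>0 \<gamma>' F
    using that cocomplete_has_colimit[OF assms(4,5)]
    by (auto simp: is_colimit_def cocone_def fibre_functor_def)
  have diagram: "cocartesian_diagram C X B T \<Phi> I \<gamma> X\<^sub>0 \<gamma>'"
    if "is_colimit C B (comp_map \<Phi> T) I \<gamma>" "cocartesian_choice X B \<Phi> C T I \<gamma> X\<^sub>0 \<gamma>'" for I \<gamma> X\<^sub>0 \<gamma>'
    using that by unfold_locales
  note fibre_functor = cocartesian_diagram.ex_fibre_functor[OF diagram]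
  note total = cocartesian_diagram.colimit_total[OF diagram assms(1)]
  \<comment> \<open>Running the four stages once, with any available choices, yields a colimit of
    \<open>T\<close>.\<close>
  have "\<exists>Y \<nu>. is_colimit C X T Y \<nu>"
    using base choice fibre_functor fibre_colimit total by metis
  then show ?thesis
    using base choice fibre_functor fibre_colimit total by (intro conjI allI impI) blast+
qed

end
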